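(* Let $(G,p,q)$ be a generic linearly constrained framework in $\mathbb{R}^d$, where $G=(V,E,L)$ has at least two vertices, and suppose $(\omega,\lambda)$ is a full rank equilibrium stress for $(G,p,q)$. Then $(G,p,q)$ is globally rigid.
   Context: A looped simple graph $G=(V,E,L)$: $E$ is a set of non-loop edges with no parallel edges, $L$ a set of loops (several may be at one vertex). A $d$-dimensional linearly constrained framework is $(G,p,q)$ with $p:V\to\mathbb{R}^d$, $q:L\to\mathbb{R}^d$; generic means all coordinates of $p,q$ are algebraically independent over $\mathbb{Q}$. $(G,p',q)$ is equivalent to $(G,p,q)$ if $\|p(u)-p(v)\|=\|p'(u)-p'(v)\|$ for all $uv\in E$ and $p(v)\cdot q(\ell)=p'(v)\cdot q(\ell)$ for each loop $\ell$ at $v$; $(G,p,q)$ is globally rigid if its only equivalent framework is itself. An equilibrium stress is a pair $\omega:E\to\mathbb{R}$, $\lambda:L\to\mathbb{R}$ such that for every vertex $v$, $\sum_{uv\in E}\omega(uv)(p(v)-p(u))+\sum_{\ell\in L\text{ at }v}\lambda(\ell)q(\ell)=0$ (equivalently $(\omega,\lambda)$ lies in the cokernel of the rigidity matrix). The stress matrix $\Omega(\omega)$ is the $|V|\times|V|$ matrix with $(u,v)$ entry $-\omega(uv)$ if $uv\in E$, $0$ if $u\ne v$ are nonadjacent, and diagonal entry $\sum_{uv\in E}\omega(uv)$ at $v$. The stress is full rank if $\operatorname{rank}\Omega(\omega)=|V|-1$. *)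

theory Defs
  imports "HOL-Analysis.Analysis" "HOL-Library.Poly_Mapping"
begin

text \<open>The vertex set of a graph is the whole of a finite type \<open>'v\<close>. The loops form a finite
  set, possibly empty and possibly with several loops at one vertex: \<open>loop_at\<close> gives the vertex of
  a loop.\<close>

record ('v, 'l) looped_graph =
  edges :: "'v set set"
  loops :: "'l set"
  loop_at :: "'l \<Rightarrow> 'v"

definition looped_simple_graph :: "('v::finite, 'l) looped_graph \<Rightarrow> bool" where
  "looped_simple_graph G \<longleftrightarrow> (\<forall>e \<in> edges G. card e = 2) \<and> finite (loops G)"

definition neighbours :: "('v::finite, 'l) looped_graph \<Rightarrow> 'v \<Rightarrow> 'v set" where
  "neighbours G v = {u. {u, v} \<in> edges G}"

definition loops_at :: "('v::finite, 'l) looped_graph \<Rightarrow> 'v \<Rightarrow> 'l set" where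
  "loops_at G v = {l \<in> loops G. loop_at G l = v}"

text \<open>A polynomial over \<open>\<rat>\<close> in indeterminates indexed by \<open>'i\<close> is a finitely supported map from
  monomials (finitely supported exponent maps) to coefficients. Below it is evaluated at the real
  point \<open>x\<close>.\<close>

definition eval_rat_poly :: "(('i \<Rightarrow>\<^sub>0 nat) \<Rightarrow>\<^sub>0 rat) \<Rightarrow> ('i \<Rightarrow> real) \<Rightarrow> real" where
  "eval_rat_poly P x =
     (\<Sum>m \<in> Poly_Mapping.keys P. of_rat (Poly_Mapping.lookup P m) * (\<Prod>i \<in> Poly_Mapping.keys m. x i ^ Poly_Mapping.lookup m i))"

text \<open>Algebraic independence is that of the indexed family \<open>x\<close> over \<open>I\<close>, so it forces distinct
  indices to carry distinct values.\<close>

definition algebraically_independent_over_rat :: "'i set \<Rightarrow> ('i \<Rightarrow> real) \<Rightarrow> bool" where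
  "algebraically_independent_over_rat I x \<longleftrightarrow>
     (\<forall>P :: ('i \<Rightarrow>\<^sub>0 nat) \<Rightarrow>\<^sub>0 rat.
        (\<forall>m \<in> Poly_Mapping.keys P. Poly_Mapping.keys m \<subseteq> I) \<longrightarrow> eval_rat_poly P x = 0 \<longrightarrow> P = 0)"

definition framework_coordinate ::
    "('v \<Rightarrow> real^'d) \<Rightarrow> ('l \<Rightarrow> real^'d) \<Rightarrow> ('v \<times> 'd) + ('l \<times> 'd) \<Rightarrow> real" where
  "framework_coordinate p q = case_sum (\<lambda>(v, i). p v $ i) (\<lambda>(l, i). q l $ i)"

text \<open>In all notions below \<open>q\<close> matters only on the loops of \<open>G\<close>, and a stress only on the edges
  and loops of \<open>G\<close>.\<close>

definition generic_framework ::
    "('v::finite, 'l) looped_graph \<Rightarrow> ('v \<Rightarrow> real^'d) \<Rightarrow> ('l \<Rightarrow> real^'d) \<Rightarrow> bool" where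
  "generic_framework G p q \<longleftrightarrow>
     algebraically_independent_over_rat ((UNIV \<times> UNIV) <+> (loops G \<times> UNIV))
       (framework_coordinate p q)"

definition equivalent_frameworks ::
    "('v::finite, 'l) looped_graph \<Rightarrow> ('l \<Rightarrow> real^'d) \<Rightarrow> ('v \<Rightarrow> real^'d) \<Rightarrow> ('v \<Rightarrow> real^'d) \<Rightarrow> bool"
  where
  "equivalent_frameworks G q p p' \<longleftrightarrow>
     (\<forall>u v. {u, v} \<in> edges G \<longrightarrow> norm (p u - p v) = norm (p' u - p' v)) \<and>
     (\<forall>v. \<forall>l \<in> loops_at G v. p v \<bullet> q l = p' v \<bullet> q l)"

definition globally_rigid ::
    "('v::finite, 'l) looped_graph \<Rightarrow> ('v \<Rightarrow> real^'d) \<Rightarrow> ('l \<Rightarrow> real^'d) \<Rightarrow> bool" where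
  "globally_rigid G p q \<longleftrightarrow> (\<forall>p'. equivalent_frameworks G q p p' \<longrightarrow> p' = p)"

definition equilibrium_stress ::
    "('v::finite, 'l) looped_graph \<Rightarrow> ('v \<Rightarrow> real^'d) \<Rightarrow> ('l \<Rightarrow> real^'d) \<Rightarrow>
     ('v set \<Rightarrow> real) \<Rightarrow> ('l \<Rightarrow> real) \<Rightarrow> bool" where
  "equilibrium_stress G p q \<omega> \<mu> \<longleftrightarrow>
     (\<forall>v. (\<Sum>u \<in> neighbours G v. \<omega> {u, v} *\<^sub>R (p v - p u)) +
          (\<Sum>l \<in> loops_at G v. \<mu> l *\<^sub>R q l) = 0)"

definition stress_matrix ::
    "('v::finite, 'l) looped_graph \<Rightarrow> ('v set \<Rightarrow> real) \<Rightarrow> real^'v^'v" where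
  "stress_matrix G \<omega> =
     (\<chi> u v. if u = v then \<Sum>w \<in> neighbours G v. \<omega> {w, v}
             else if {u, v} \<in> edges G then - \<omega> {u, v} else 0)"

definition full_rank_stress :: "('v::finite, 'l) looped_graph \<Rightarrow> ('v set \<Rightarrow> real) \<Rightarrow> bool" where
  "full_rank_stress G \<omega> \<longleftrightarrow> rank (stress_matrix G \<omega>) = CARD('v) - 1"

end

theory Submission
  imports Defs "HOL-Computational_Algebra.Polynomial"
begin

text \<open>Let \<open>(G, p', q)\<close> be equivalent to \<open>(G, p, q)\<close>, and let \<open>f\<close> be the polynomial map recording the
  squared edge lengths, the loop products \<open>p v \<bullet> q l\<close> and the coordinates of \<open>q\<close>, so that \<open>f\<close> agrees
  at \<open>x = (p, q)\<close> and \<open>y = (p', q)\<close>. For any direction \<open>w\<close>, the map \<open>h x \<mapsto> dh\<^sub>y(w)\<close>, where \<open>h\<close> ranges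
  over the rational polynomials with \<open>h x = h y\<close>, is well defined as \<open>x\<close> is generic, and is a
  derivation. Extend it to a ring containing the coordinates of \<open>x\<close>; its values there form a vector
  \<open>z\<close> with \<open>df\<^sub>x(z) = df\<^sub>y(w)\<close>. Hence every covector annihilating the image of \<open>df\<^sub>x\<close> annihilates
  that of \<open>df\<^sub>y\<close>. Because \<open>q\<close> is among the variables, this yields two things from a stress \<open>(\<omega>, \<mu>)\<close> at
  \<open>p\<close>: it is a stress at \<open>p'\<close>, and \<open>p' v = p v\<close> wherever some loop \<open>l\<close> at \<open>v\<close> has \<open>\<mu> l \<noteq> 0\<close>. By full
  rank, \<open>p' - p\<close> is a translation, so it is zero as soon as \<open>\<mu> \<noteq> 0\<close>; and \<open>\<mu> = 0\<close> would put all
  points of \<open>p\<close> at the same place.\<close>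

section \<open>Extending derivations\<close>

text \<open>Only the domain of \<open>D\<close> is restricted: \<open>D\<close> takes values
  anywhere in the field, so it need not map \<open>A\<close> into itself.\<close>

locale subring_derivation =
  fixes A :: "'a::field_char_0 set" and D :: "'a \<Rightarrow> 'a"
  assumes one_mem: "1 \<in> A"
    and add_mem: "\<lbrakk>a \<in> A; b \<in> A\<rbrakk> \<Longrightarrow> a + b \<in> A"
    and uminus_mem: "a \<in> A \<Longrightarrow> - a \<in> A"
    and mult_mem: "\<lbrakk>a \<in> A; b \<in> A\<rbrakk> \<Longrightarrow> a * b \<in> A"
    and D_add: "\<lbrakk>a \<in> A; b \<in> A\<rbrakk> \<Longrightarrow> D (a + b) = D a + D b"
    and D_mult: "\<lbrakk>a \<in> A; b \<in> A\<rbrakk> \<Longrightarrow> D (a * b) = D a * b + a * D b"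
begin

lemma zero_mem: "0 \<in> A"
  using add_mem[OF one_mem uminus_mem[OF one_mem]] by simp

lemma D_zero [simp]: "D 0 = 0"
  using D_add[OF zero_mem zero_mem] by simp

lemma D_uminus: "a \<in> A \<Longrightarrow> D (- a) = - D a"
  using D_add[of a "- a"] uminus_mem[of a] by (simp add: eq_neg_iff_add_eq_0 add.commute)

lemma diff_mem: "\<lbrakk>a \<in> A; b \<in> A\<rbrakk> \<Longrightarrow> a - b \<in> A"
  using add_mem[of a "- b"] uminus_mem[of b] by simp

lemma D_diff: "\<lbrakk>a \<in> A; b \<in> A\<rbrakk> \<Longrightarrow> D (a - b) = D a - D b"
  using D_add[of a "- b"] uminus_mem[of b] D_uminus[of b] by simp

lemma sum_mem: "(\<And>i. i \<in> I \<Longrightarrow> f i \<in> A) \<Longrightarrow> (\<Sum>i\<in>I. f i) \<in> A"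
  by (induction I rule: infinite_finite_induct) (auto simp: zero_mem add_mem)

lemma D_sum: "(\<And>i. i \<in> I \<Longrightarrow> f i \<in> A) \<Longrightarrow> D (\<Sum>i\<in>I. f i) = (\<Sum>i\<in>I. D (f i))"
  by (induction I rule: infinite_finite_induct) (auto simp: D_add sum_mem)

lemma of_nat_mem: "of_nat n \<in> A"
  by (induction n) (auto simp: zero_mem one_mem add_mem)

section \<open>Polynomials with coefficients in the subring\<close>

definition polys :: "'a poly set" where
  "polys = {P. \<forall>i. coeff P i \<in> A}"

lemma polys_add: "\<lbrakk>P \<in> polys; Q \<in> polys\<rbrakk> \<Longrightarrow> P + Q \<in> polys"
  by (simp add: polys_def add_mem)

lemma polys_diff: "\<lbrakk>P \<in> polys; Q \<in> polys\<rbrakk> \<Longrightarrow> P - Q \<in> polys"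
  by (simp add: polys_def diff_mem)

lemma polys_uminus: "P \<in> polys \<Longrightarrow> - P \<in> polys"
  by (simp add: polys_def uminus_mem)

lemma polys_mult: "\<lbrakk>P \<in> polys; Q \<in> polys\<rbrakk> \<Longrightarrow> P * Q \<in> polys"
  by (auto simp: polys_def coeff_mult intro!: sum_mem mult_mem)

lemma polys_monom: "c \<in> A \<Longrightarrow> monom c n \<in> polys"
  by (simp add: polys_def zero_mem)

lemma polys_pderiv: "P \<in> polys \<Longrightarrow> pderiv P \<in> polys"
  by (auto simp: polys_def coeff_pderiv simp del: of_nat_Suc intro!: mult_mem of_nat_mem)

lemma map_poly_D_add:
  "\<lbrakk>P \<in> polys; Q \<in> polys\<rbrakk> \<Longrightarrow> map_poly D (P + Q) = map_poly D P + map_poly D Q"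
  by (rule poly_eqI) (simp add: coeff_map_poly polys_def D_add)

lemma map_poly_D_mult:
  assumes "P \<in> polys" "Q \<in> polys"
  shows "map_poly D (P * Q) = map_poly D P * Q + P * map_poly D Q"
  using assms
  by (intro poly_eqI)
     (simp add: coeff_map_poly polys_def coeff_mult D_sum mult_mem D_mult sum.distrib)

text \<open>The derivative that \<open>poly P a\<close> must get once \<open>a\<close> is given
  derivative \<open>b\<close>. It is attached to \<open>P\<close> because different polynomials may
  share their value at \<open>a\<close>.\<close>

definition extend :: "'a \<Rightarrow> 'a \<Rightarrow> 'a poly \<Rightarrow> 'a" where
  "extend a b P = poly (map_poly D P) a + poly (pderiv P) a * b"

lemma extend_add:
  "\<lbrakk>P \<in> polys; Q \<in> polys\<rbrakk> \<Longrightarrow> extend a b (P + Q) = extend a b P + extend a b Q"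
  by (simp add: extend_def map_poly_D_add pderiv_add algebra_simps)

lemma extend_mult:
  "\<lbrakk>P \<in> polys; Q \<in> polys\<rbrakk> \<Longrightarrow>
    extend a b (P * Q) = extend a b P * poly Q a + poly P a * extend a b Q"
  by (simp add: extend_def map_poly_D_mult pderiv_mult algebra_simps)

lemma extend_0 [simp]: "extend a b 0 = 0"
  by (simp add: extend_def)

lemma extend_diff:
  "\<lbrakk>P \<in> polys; Q \<in> polys\<rbrakk> \<Longrightarrow> extend a b (P - Q) = extend a b P - extend a b Q"
  using extend_add[of "P - Q" Q] by (simp add: polys_diff)

lemma extend_const: "extend a b [:c:] = D c"
  by (simp add: extend_def map_poly_pCons)

text \<open>This choice of \<open>b\<close> makes \<open>extend a b P\<close> depend on
  \<open>poly P a\<close> alone. For algebraic \<open>a\<close>, a relation of least degree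
  determines \<open>b\<close>, and pseudo-division by it handles all other relations.\<close>

lemma extend_eq_0:
  obtains b where "\<And>Q. \<lbrakk>Q \<in> polys; poly Q a = 0\<rbrakk> \<Longrightarrow> extend a b Q = 0"
proof (cases "\<exists>P \<in> polys. P \<noteq> 0 \<and> poly P a = 0")
  case False
  \<comment> \<open>Here \<open>a\<close> is transcendental over \<open>A\<close>, so any
    \<open>b\<close> works.\<close>
  then show thesis using that by (metis extend_0)
next
  case True
  define R where "R P \<longleftrightarrow> P \<in> polys \<and> P \<noteq> 0 \<and> poly P a = 0" for P
  obtain P where P: "R P" and P_min: "\<And>Q. R Q \<Longrightarrow> degree P \<le> degree Q"
    using True ex_has_least_nat[of R _ degree] by (metis R_def)
  have "degree P \<noteq> 0"
  proof
    assume "degree P = 0"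
    then obtain c where "P = [:c:]" by (rule degree_eq_zeroE)
    then show False using P by (simp add: R_def)
  qed
  \<comment> \<open>Characteristic 0 makes the derivative nonzero, and minimality of
    \<open>degree P\<close> then forbids it to vanish at \<open>a\<close>.\<close>
  then have "pderiv P \<noteq> 0" "degree (pderiv P) < degree P"
    by (auto simp: pderiv_eq_0_iff degree_pderiv)
  with P P_min[of "pderiv P"] have P': "poly (pderiv P) a \<noteq> 0"
    by (auto simp: R_def polys_pderiv)
  define b where "b = - poly (map_poly D P) a / poly (pderiv P) a"
  have extP: "extend a b P = 0"
    using P' by (simp add: extend_def b_def)
  have "extend a b Q = 0" if "Q \<in> polys" "poly Q a = 0" for Q
    using that
  proof (induction "degree Q" arbitrary: Q rule: less_induct)
    case less
    show ?case
    proof (cases "Q = 0")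
      case False
      then have deg: "degree P \<le> degree Q"
        using P_min[of Q] less.prems by (simp add: R_def)
      \<comment> \<open>\<open>A\<close> is only a ring, so instead of dividing by
        \<open>lead_coeff P\<close>, \<open>Q\<close> is multiplied by it before the leading term is
        cancelled.\<close>
      define M where "M = monom (lead_coeff Q) (degree Q - degree P)"
      define C where "C = monom (lead_coeff P) 0"
      have mem: "M \<in> polys" "C \<in> polys" "P \<in> polys"
        using less.prems P by (auto simp: M_def C_def R_def polys_def intro!: zero_mem)
      define Q2 where "Q2 = C * Q - M * P"
      have Q2_mem: "Q2 \<in> polys" and Q2_root: "poly Q2 a = 0"
        using mem less.prems P by (auto simp: Q2_def R_def intro!: polys_diff polys_mult)
      have le: "degree Q2 \<le> degree Q"
      proof -
        have "degree (C * Q) \<le> degree Q"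
          using degree_mult_le[of C Q] by (simp add: C_def monom_0)
        moreover have "degree (M * P) \<le> degree Q"
          using degree_mult_le[of M P] degree_monom_le[of "lead_coeff Q" "degree Q - degree P"] deg
          by (simp add: M_def)
        ultimately show ?thesis unfolding Q2_def by (rule degree_diff_le)
      qed
      have "coeff Q2 (degree Q) = 0"
        using deg by (simp add: Q2_def C_def M_def coeff_monom_mult)
      then have "Q2 = 0 \<or> degree Q2 < degree Q"
        using le by (metis le_neq_implies_less leading_coeff_0_iff)
      then have "extend a b Q2 = 0"
        using less.hyps Q2_mem Q2_root by auto
      \<comment> \<open>All other Leibniz terms contain \<open>poly Q a\<close>,
        \<open>poly P a\<close> or \<open>extend a b P\<close>, which are 0.\<close>
      moreover have "extend a b Q2 = poly C a * extend a b Q"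
        using mem less.prems P extP
        by (simp add: Q2_def extend_diff polys_mult extend_mult R_def)
      moreover have "poly C a \<noteq> 0"
        using P by (simp add: C_def poly_monom R_def)
      ultimately show ?thesis by simp
    qed simp
  qed
  then show thesis by (rule that)
qed

lemma extend_one:
  obtains A' D' where "subring_derivation A' D'" "A \<subseteq> A'" "a \<in> A'" "\<And>c. c \<in> A \<Longrightarrow> D' c = D c"
proof -
  obtain b where b: "\<And>Q. \<lbrakk>Q \<in> polys; poly Q a = 0\<rbrakk> \<Longrightarrow> extend a b Q = 0"
    using extend_eq_0[of a] by metis
  \<comment> \<open>This is the ring \<open>A[a]\<close>. In \<open>D'\<close> any representing
    polynomial serves, since two of them differ by one vanishing at \<open>a\<close>.\<close>
  define A' where "A' = (\<lambda>P. poly P a) ` polys"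
  define D' where "D' z = extend a b (SOME P. P \<in> polys \<and> poly P a = z)" for z
  have D': "D' (poly P a) = extend a b P" if P: "P \<in> polys" for P
  proof -
    define Q where "Q = (SOME Q. Q \<in> polys \<and> poly Q a = poly P a)"
    have "Q \<in> polys \<and> poly Q a = poly P a"
      unfolding Q_def by (rule someI[of _ P]) (simp add: P)
    then have "extend a b (Q - P) = 0" "Q \<in> polys"
      using P by (auto intro!: b polys_diff)
    then show ?thesis
      using P by (simp add: extend_diff D'_def Q_def)
  qed
  have const: "[:c:] \<in> polys" if "c \<in> A" for c
    using polys_monom[OF that, of 0] by (simp add: monom_0)
  show thesis
  proof
    show "subring_derivation A' D'"
    proof
      show "1 \<in> A'"
        unfolding A'_def using const[OF one_mem] by (rule rev_image_eqI) simp
      fix z assume "z \<in> A'"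
      then obtain P where P: "P \<in> polys" "z = poly P a" by (auto simp: A'_def)
      show "- z \<in> A'"
        unfolding A'_def using polys_uminus[OF P(1)] by (rule rev_image_eqI) (simp add: P)
      fix z' assume "z' \<in> A'"
      then obtain Q where Q: "Q \<in> polys" "z' = poly Q a" by (auto simp: A'_def)
      show "z + z' \<in> A'"
        unfolding A'_def using polys_add[OF P(1) Q(1)] by (rule rev_image_eqI) (simp add: P Q)
      show "z * z' \<in> A'"
        unfolding A'_def using polys_mult[OF P(1) Q(1)] by (rule rev_image_eqI) (simp add: P Q)
      show "D' (z + z') = D' z + D' z'"
        using D'[OF polys_add[OF P(1) Q(1)]] by (simp add: P Q D' extend_add)
      show "D' (z * z') = D' z * z' + z * D' z'"
        using D'[OF polys_mult[OF P(1) Q(1)]] by (simp add: P Q D' extend_mult)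
    qed
    show "A \<subseteq> A'"
    proof
      fix c assume "c \<in> A"
      from const[OF this] show "c \<in> A'" unfolding A'_def by (rule rev_image_eqI) simp
    qed
    have X: "monom 1 1 \<in> polys" by (rule polys_monom[OF one_mem])
    show "a \<in> A'"
      unfolding A'_def using X by (rule rev_image_eqI) (simp add: poly_monom)
    show "D' c = D c" if "c \<in> A" for c
      using D'[OF const[OF that]] by (simp add: extend_const)
  qed
qed

end

lemma subring_derivation_extend:
  assumes "finite S" "subring_derivation A D"
  obtains A' D' where "subring_derivation A' D'" "A \<subseteq> A'" "S \<subseteq> A'" "\<And>c. c \<in> A \<Longrightarrow> D' c = D c"
  using assms
proof (induction S arbitrary: thesis rule: finite_induct)
  case empty
  then show ?case by blast
next
  case (insert a S)
  obtain A1 D1 where 1: "subring_derivation A1 D1" "A \<subseteq> A1" "S \<subseteq> A1"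
    "\<And>c. c \<in> A \<Longrightarrow> D1 c = D c"
    using insert.IH insert.prems(2) by blast
  obtain A2 D2 where 2: "subring_derivation A2 D2" "A1 \<subseteq> A2" "a \<in> A2"
    "\<And>c. c \<in> A1 \<Longrightarrow> D2 c = D1 c"
    using subring_derivation.extend_one[OF 1(1)] by metis
  show ?case
    by (rule insert.prems(1)[of A2 D2]) (use 1 2 in auto)
qed

section \<open>Rational polynomial functions\<close>

text \<open>Functions replace formal polynomials so that they can be evaluated at several points and
  differentiated along lines.\<close>

definition rat_polyfuns :: "'i set \<Rightarrow> (('i \<Rightarrow> real) \<Rightarrow> real) set" where
  "rat_polyfuns I = {eval_rat_poly P |P. \<forall>m \<in> Poly_Mapping.keys P. Poly_Mapping.keys m \<subseteq> I}"

definition monomial_value :: "('i \<Rightarrow> real) \<Rightarrow> ('i \<Rightarrow>\<^sub>0 nat) \<Rightarrow> real" where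
  "monomial_value x m = (\<Prod>i\<in>Poly_Mapping.keys m. x i ^ Poly_Mapping.lookup m i)"

lemma monomial_value_superset:
  assumes "finite K" "Poly_Mapping.keys m \<subseteq> K"
  shows "monomial_value x m = (\<Prod>i\<in>K. x i ^ Poly_Mapping.lookup m i)"
  unfolding monomial_value_def
  by (rule prod.mono_neutral_left) (use assms in \<open>auto simp: in_keys_iff\<close>)

lemma monomial_value_add: "monomial_value x (m + n) = monomial_value x m * monomial_value x n"
proof -
  let ?K = "Poly_Mapping.keys m \<union> Poly_Mapping.keys n"
  have "Poly_Mapping.keys (m + n) \<subseteq> ?K" by (rule Poly_Mapping.keys_add)
  then show ?thesis
    by (simp add: monomial_value_superset[of ?K] lookup_add power_add prod.distrib)
qed

lemma eval_rat_poly_superset: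
  assumes "finite K" "Poly_Mapping.keys P \<subseteq> K"
  shows "eval_rat_poly P x = (\<Sum>m\<in>K. of_rat (Poly_Mapping.lookup P m) * monomial_value x m)"
  unfolding eval_rat_poly_def monomial_value_def
  by (rule sum.mono_neutral_left) (use assms in \<open>auto simp: in_keys_iff\<close>)

lemma eval_rat_poly_add: "eval_rat_poly (P + Q) x = eval_rat_poly P x + eval_rat_poly Q x"
proof -
  let ?K = "Poly_Mapping.keys P \<union> Poly_Mapping.keys Q"
  have "Poly_Mapping.keys (P + Q) \<subseteq> ?K" by (rule Poly_Mapping.keys_add)
  then show ?thesis
    by (simp add: eval_rat_poly_superset[of ?K] lookup_add of_rat_add distrib_right sum.distrib)
qed

lemma eval_rat_poly_single: "eval_rat_poly (Poly_Mapping.single m c) x = of_rat c * monomial_value x m"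
  by (simp add: eval_rat_poly_superset[of "{m}"])

lemma rat_polyfuns_add:
  assumes "f \<in> rat_polyfuns I" "g \<in> rat_polyfuns I"
  shows "(\<lambda>x. f x + g x) \<in> rat_polyfuns I"
proof -
  obtain P Q where "f = eval_rat_poly P" "\<forall>m \<in> Poly_Mapping.keys P. Poly_Mapping.keys m \<subseteq> I"
    "g = eval_rat_poly Q" "\<forall>m \<in> Poly_Mapping.keys Q. Poly_Mapping.keys m \<subseteq> I"
    using assms by (auto simp: rat_polyfuns_def)
  then show ?thesis
    using Poly_Mapping.keys_add[of P Q] unfolding rat_polyfuns_def
    by (intro CollectI exI[of _ "P + Q"]) (auto simp: fun_eq_iff eval_rat_poly_add, blast)
qed

lemma rat_polyfuns_monomial:
  "Poly_Mapping.keys m \<subseteq> I \<Longrightarrow> (\<lambda>x. of_rat c * monomial_value x m) \<in> rat_polyfuns I"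
  by (auto simp: rat_polyfuns_def fun_eq_iff eval_rat_poly_single split: if_splits
      intro!: exI[of _ "Poly_Mapping.single m c"])

lemma rat_polyfuns_const: "(\<lambda>x. of_rat c) \<in> rat_polyfuns I"
  using rat_polyfuns_monomial[of 0 I c] by (simp add: monomial_value_def)

lemma rat_polyfuns_coord: "i \<in> I \<Longrightarrow> (\<lambda>x. x i) \<in> rat_polyfuns I"
  using rat_polyfuns_monomial[of "Poly_Mapping.single i 1" I 1] by (simp add: monomial_value_def)

lemma rat_polyfuns_sum:
  "(\<And>j. j \<in> J \<Longrightarrow> f j \<in> rat_polyfuns I) \<Longrightarrow> (\<lambda>x. \<Sum>j\<in>J. f j x) \<in> rat_polyfuns I"
proof (induction J rule: infinite_finite_induct)
  case (insert j J)
  then show ?case by (simp add: rat_polyfuns_add)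
qed (use rat_polyfuns_const[of 0] in auto)

lemma rat_polyfuns_mult:
  assumes "f \<in> rat_polyfuns I" "g \<in> rat_polyfuns I"
  shows "(\<lambda>x. f x * g x) \<in> rat_polyfuns I"
proof -
  obtain P Q where P: "f = eval_rat_poly P" "\<forall>m \<in> Poly_Mapping.keys P. Poly_Mapping.keys m \<subseteq> I"
    and Q: "g = eval_rat_poly Q" "\<forall>m \<in> Poly_Mapping.keys Q. Poly_Mapping.keys m \<subseteq> I"
    using assms by (auto simp: rat_polyfuns_def)
  let ?P = "Poly_Mapping.keys P" and ?Q = "Poly_Mapping.keys Q"
  \<comment> \<open>Expanding into monomials reduces the product to closure under sums, without
    multiplying formal polynomials.\<close>
  have "f x * g x = (\<Sum>m\<in>?P. \<Sum>n\<in>?Q.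
      of_rat (Poly_Mapping.lookup P m * Poly_Mapping.lookup Q n) * monomial_value x (m + n))" for x
    by (simp add: P Q eval_rat_poly_superset[of ?P] eval_rat_poly_superset[of ?Q] sum_product
        monomial_value_add of_rat_mult mult_ac)
  moreover have "Poly_Mapping.keys (m + n) \<subseteq> I" if "m \<in> ?P" "n \<in> ?Q" for m n
    using that P Q Poly_Mapping.keys_add[of m n] by blast
  ultimately show ?thesis
    by (auto intro!: rat_polyfuns_sum rat_polyfuns_monomial)
qed

lemma rat_polyfuns_uminus: "f \<in> rat_polyfuns I \<Longrightarrow> (\<lambda>x. - f x) \<in> rat_polyfuns I"
  using rat_polyfuns_mult[OF rat_polyfuns_const[of "-1"], of f I] by (simp add: of_rat_minus)

lemma rat_polyfuns_diff:
  "\<lbrakk>f \<in> rat_polyfuns I; g \<in> rat_polyfuns I\<rbrakk> \<Longrightarrow> (\<lambda>x. f x - g x) \<in> rat_polyfuns I"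
  using rat_polyfuns_add[OF _ rat_polyfuns_uminus, of f I g] by simp

text \<open>A polynomial representing \<open>f - g\<close> vanishes at the generic point, hence is
  0. Every use of genericity passes through this fact.\<close>

lemma rat_polyfuns_eqI:
  assumes "algebraically_independent_over_rat I x" "f \<in> rat_polyfuns I" "g \<in> rat_polyfuns I"
    and "f x = g x"
  shows "f = g"
proof -
  obtain P where P: "(\<lambda>x. f x - g x) = eval_rat_poly P"
    "\<forall>m \<in> Poly_Mapping.keys P. Poly_Mapping.keys m \<subseteq> I"
    using rat_polyfuns_diff[OF assms(2,3)] by (auto simp: rat_polyfuns_def)
  then have "P = 0"
    using assms(1,4) fun_cong[OF P(1), of x] by (auto simp: algebraically_independent_over_rat_def)
  then have "f z - g z = 0" for z
    using fun_cong[OF P(1), of z] by (simp add: eval_rat_poly_def)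
  then show ?thesis by (simp add: fun_eq_iff)
qed

lemma rat_polyfuns_field_differentiable:
  assumes "f \<in> rat_polyfuns I"
  shows "(\<lambda>t. f (\<lambda>i. y i + t * w i)) field_differentiable (at t)"
proof -
  obtain P where f: "f = eval_rat_poly P" using assms by (auto simp: rat_polyfuns_def)
  have "(\<lambda>t. \<Prod>i\<in>K. (y i + t * w i) ^ n i) field_differentiable (at t)"
    if "finite K" for K n
    using that by induction (auto intro!: derivative_intros)
  then show ?thesis
    unfolding f eval_rat_poly_def
    by (intro field_differentiable_sum field_differentiable_mult field_differentiable_const) simp
qed

text \<open>The polynomial functions agreeing at \<open>x\<close> and \<open>y\<close> form a ring
  on which evaluation at \<open>x\<close> is injective, so differentiation at \<open>y\<close> along
  \<open>w\<close> becomes a derivation on their values at \<open>x\<close>. It is then extended to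
  \<open>S\<close>.\<close>

lemma generic_derivation:
  fixes x y w :: "'i \<Rightarrow> real"
  assumes gen: "algebraically_independent_over_rat I x" and "finite S"
  obtains A D where "subring_derivation A D" "S \<subseteq> A"
    "\<And>h. \<lbrakk>h \<in> rat_polyfuns I; h x = h y\<rbrakk> \<Longrightarrow> h x \<in> A"
    "\<And>h d. \<lbrakk>h \<in> rat_polyfuns I; h x = h y;
       ((\<lambda>t. h (\<lambda>i. y i + t * w i)) has_real_derivative d) (at 0)\<rbrakk> \<Longrightarrow> D (h x) = d"
proof -
  define H where "H = {h \<in> rat_polyfuns I. h x = h y}"
  define dir where "dir h = deriv (\<lambda>t. h (\<lambda>i. y i + t * w i)) 0" for h :: "('i \<Rightarrow> real) \<Rightarrow> real"
  define D where "D a = dir (SOME h. h \<in> H \<and> h x = a)" for a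
  have D: "D (h x) = dir h" if "h \<in> H" for h
  proof -
    \<comment> \<open>By genericity the value at \<open>x\<close> determines the function, so the
      choice is forced.\<close>
    have "(SOME g. g \<in> H \<and> g x = h x) = h"
      using that rat_polyfuns_eqI[OF gen] by (intro some_equality) (auto simp: H_def)
    then show ?thesis by (simp add: D_def)
  qed
  have dir: "((\<lambda>t. h (\<lambda>i. y i + t * w i)) has_real_derivative dir h) (at 0)" if "h \<in> H" for h
    using that rat_polyfuns_field_differentiable unfolding dir_def H_def
    by (auto simp: DERIV_deriv_iff_field_differentiable)
  have "subring_derivation ((\<lambda>h. h x) ` H) D"
  proof
    have "(\<lambda>x. 1) \<in> H" using rat_polyfuns_const[of 1 I] by (simp add: H_def)
    then show "1 \<in> (\<lambda>h. h x) ` H" by (rule rev_image_eqI) simp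
    fix a assume "a \<in> (\<lambda>h. h x) ` H"
    then obtain f where f: "f \<in> H" "a = f x" by auto
    have "(\<lambda>x. - f x) \<in> H" using f by (simp add: H_def rat_polyfuns_uminus)
    then show "- a \<in> (\<lambda>h. h x) ` H" by (rule rev_image_eqI) (simp add: f)
    fix b assume "b \<in> (\<lambda>h. h x) ` H"
    then obtain g where g: "g \<in> H" "b = g x" by auto
    have add: "(\<lambda>x. f x + g x) \<in> H" using f g by (simp add: H_def rat_polyfuns_add)
    then show "a + b \<in> (\<lambda>h. h x) ` H" by (rule rev_image_eqI) (simp add: f g)
    have mult: "(\<lambda>x. f x * g x) \<in> H" using f g by (simp add: H_def rat_polyfuns_mult)
    then show "a * b \<in> (\<lambda>h. h x) ` H" by (rule rev_image_eqI) (simp add: f g)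
    have "dir (\<lambda>x. f x + g x) = dir f + dir g"
      using dir[OF f(1)] dir[OF g(1)]
      unfolding dir_def[of "\<lambda>x. f x + g x"] by (intro DERIV_imp_deriv DERIV_add)
    then show "D (a + b) = D a + D b"
      using D[OF add] D[OF f(1)] D[OF g(1)] by (simp add: f g)
    \<comment> \<open>The product rule at \<open>y\<close> yields \<open>f y\<close> and
      \<open>g y\<close>; membership in \<open>H\<close> turns them into \<open>a\<close> and
      \<open>b\<close>, which gives the Leibniz rule at \<open>x\<close>.\<close>
    have "dir (\<lambda>x. f x * g x) = dir f * g y + dir g * f y"
      using DERIV_mult[OF dir[OF f(1)] dir[OF g(1)]]
      unfolding dir_def[of "\<lambda>x. f x * g x"] by (intro DERIV_imp_deriv) simp
    then show "D (a * b) = D a * b + a * D b"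
      using D[OF mult] D[OF f(1)] D[OF g(1)] f g by (simp add: H_def)
  qed
  then obtain A' D' where A': "subring_derivation A' D'" "(\<lambda>h. h x) ` H \<subseteq> A'" "S \<subseteq> A'"
    "\<And>c. c \<in> (\<lambda>h. h x) ` H \<Longrightarrow> D' c = D c"
    using subring_derivation_extend[OF \<open>finite S\<close>] by metis
  show thesis
  proof (rule that[OF A'(1,3)])
    fix h assume "h \<in> rat_polyfuns I" "h x = h y"
    then have h: "h \<in> H" by (simp add: H_def)
    then show "h x \<in> A'" using A'(2) by blast
    fix d assume "((\<lambda>t. h (\<lambda>i. y i + t * w i)) has_real_derivative d) (at 0)"
    then have "dir h = d" unfolding dir_def by (rule DERIV_imp_deriv)
    then show "D' (h x) = d" using A'(4) D[OF h] h by simp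
  qed
qed

section \<open>Stresses of equivalent frameworks\<close>

lemma sum_neighbours_swap:
  fixes f :: "'v::finite \<Rightarrow> 'v \<Rightarrow> real"
  shows "(\<Sum>v\<in>UNIV. \<Sum>u\<in>neighbours G v. f u v) = (\<Sum>v\<in>UNIV. \<Sum>u\<in>neighbours G v. f v u)"
proof -
  have "(\<Sum>v\<in>UNIV. \<Sum>u\<in>neighbours G v. f u v)
      = (\<Sum>v\<in>UNIV. \<Sum>u\<in>UNIV. if {u, v} \<in> edges G then f u v else 0)"
    by (simp add: neighbours_def sum.If_cases)
  also have "\<dots> = (\<Sum>u\<in>UNIV. \<Sum>v\<in>UNIV. if {u, v} \<in> edges G then f u v else 0)"
    by (rule sum.swap)
  also have "\<dots> = (\<Sum>v\<in>UNIV. \<Sum>u\<in>neighbours G v. f v u)"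
    by (simp add: neighbours_def sum.If_cases insert_commute)
  finally show ?thesis .
qed

text \<open>The right side runs over ordered pairs and so meets each edge twice, whence the factor
  2. It shows that the pairing depends only on the edge products
  \<open>(p v - p u) \<bullet> (z v - z u)\<close>.\<close>

lemma edge_stress_pairing:
  fixes p z :: "'v::finite \<Rightarrow> real^'d"
  shows "2 * (\<Sum>v\<in>UNIV. (\<Sum>u\<in>neighbours G v. \<omega> {u, v} *\<^sub>R (p v - p u)) \<bullet> z v)
    = (\<Sum>v\<in>UNIV. \<Sum>u\<in>neighbours G v. \<omega> {u, v} * ((p v - p u) \<bullet> (z v - z u)))"
proof -
  let ?f = "\<lambda>u v. \<omega> {u, v} * ((p v - p u) \<bullet> z v)"
  have "(\<Sum>v\<in>UNIV. \<Sum>u\<in>neighbours G v. \<omega> {u, v} * ((p v - p u) \<bullet> (z v - z u)))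
      = (\<Sum>v\<in>UNIV. \<Sum>u\<in>neighbours G v. ?f u v + ?f v u)"
    by (intro sum.cong refl) (simp add: insert_commute inner_diff_left inner_diff_right algebra_simps)
  also have "\<dots> = 2 * (\<Sum>v\<in>UNIV. \<Sum>u\<in>neighbours G v. ?f u v)"
    using sum_neighbours_swap[of ?f G] by (simp add: sum.distrib)
  finally show ?thesis by (simp add: inner_sum_left)
qed

lemma sum_power2_diff_mem_rat_polyfuns:
  assumes "\<And>k. k \<in> K \<Longrightarrow> i k \<in> I" "\<And>k. k \<in> K \<Longrightarrow> j k \<in> I"
  shows "(\<lambda>x. \<Sum>k\<in>K. (x (i k) - x (j k))\<^sup>2) \<in> rat_polyfuns I"
  unfolding power2_eq_square using assms
  by (intro rat_polyfuns_sum rat_polyfuns_mult rat_polyfuns_diff rat_polyfuns_coord)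

lemma sum_mult_mem_rat_polyfuns:
  assumes "\<And>k. k \<in> K \<Longrightarrow> i k \<in> I" "\<And>k. k \<in> K \<Longrightarrow> j k \<in> I"
  shows "(\<lambda>x. \<Sum>k\<in>K. x (i k) * x (j k)) \<in> rat_polyfuns I"
  using assms by (intro rat_polyfuns_sum rat_polyfuns_mult rat_polyfuns_coord)

text \<open>For any velocity \<open>(z', w)\<close> at \<open>(p', q)\<close>, some velocity
  \<open>(z, w)\<close> at \<open>(p, q)\<close> changes all measurements at the same rate. The part
  \<open>w\<close> is kept because \<open>q\<close> is common to both frameworks.\<close>

lemma generic_framework_transport_velocity:
  fixes G :: "('v::finite, 'l) looped_graph"
    and p p' z' :: "'v \<Rightarrow> real^'d" and q w :: "'l \<Rightarrow> real^'d"
  assumes gen: "generic_framework G p q" and equiv: "equivalent_frameworks G q p p'"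
  obtains z :: "'v \<Rightarrow> real^'d" where
    "\<And>u v. {u, v} \<in> edges G \<Longrightarrow> (p u - p v) \<bullet> (z u - z v) = (p' u - p' v) \<bullet> (z' u - z' v)"
    "\<And>v l. l \<in> loops_at G v \<Longrightarrow> z v \<bullet> q l + p v \<bullet> w l = z' v \<bullet> q l + p' v \<bullet> w l"
proof -
  define I :: "(('v \<times> 'd) + ('l \<times> 'd)) set" where "I = (UNIV \<times> UNIV) <+> (loops G \<times> UNIV)"
  let ?x = "framework_coordinate p q" and ?y = "framework_coordinate p' q"
    and ?w = "framework_coordinate z' w"
  have "algebraically_independent_over_rat I ?x"
    using gen by (simp add: generic_framework_def I_def)
  \<comment> \<open>The coordinates of \<open>p\<close> must be adjoined, as they may differ from
    those of \<open>p'\<close>; those of \<open>q\<close> lie in \<open>A\<close> anyway.\<close>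
  then obtain A D where "subring_derivation A D"
    and p_mem: "range (\<lambda>(v, i). p v $ i) \<subseteq> A"
    and mem: "\<And>h. \<lbrakk>h \<in> rat_polyfuns I; h ?x = h ?y\<rbrakk> \<Longrightarrow> h ?x \<in> A"
    and D: "\<And>h d. \<lbrakk>h \<in> rat_polyfuns I; h ?x = h ?y;
      ((\<lambda>t. h (\<lambda>i. ?y i + t * ?w i)) has_real_derivative d) (at 0)\<rbrakk> \<Longrightarrow> D (h ?x) = d"
    by (rule generic_derivation[where S = "range (\<lambda>(v, i). p v $ i)" and y = ?y and w = ?w]) auto
  interpret subring_derivation A D by fact
  have pA: "p v $ i \<in> A" for v i using p_mem by auto
  have Inl_I: "Inl (v, i) \<in> I" for v i unfolding I_def by (intro InlI) simp
  define z where "z v = (\<chi> i. D (p v $ i))" for v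
  show thesis
  proof
    fix u v assume "{u, v} \<in> edges G"
    then have "norm (p u - p v) = norm (p' u - p' v)"
      using equiv by (simp add: equivalent_frameworks_def)
    then have eq: "(\<Sum>i\<in>UNIV. (p u $ i - p v $ i)\<^sup>2) = (\<Sum>i\<in>UNIV. (p' u $ i - p' v $ i)\<^sup>2)"
      by (simp add: norm_eq_sqrt_inner inner_vec_def power2_eq_square)
    \<comment> \<open>The value of \<open>D\<close> on the squared length is computed twice: as a
      derivative at \<open>p'\<close>, and by the Leibniz rule from the coordinates of
      \<open>p\<close>.\<close>
    have "D (\<Sum>i\<in>UNIV. (p u $ i - p v $ i)\<^sup>2)
      = 2 * ((p' u - p' v) \<bullet> (z' u - z' v))"
    proof -
      let ?h = "\<lambda>x. \<Sum>i\<in>UNIV. (x (Inl (u, i)) - x (Inl (v, i)))\<^sup>2"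
      have "D (?h ?x) = 2 * ((p' u - p' v) \<bullet> (z' u - z' v))"
      proof (rule D)
        show "?h \<in> rat_polyfuns I" by (intro sum_power2_diff_mem_rat_polyfuns Inl_I)
        show "?h ?x = ?h ?y" using eq by (simp add: framework_coordinate_def)
        show "((\<lambda>t. ?h (\<lambda>i. ?y i + t * ?w i)) has_real_derivative
            2 * ((p' u - p' v) \<bullet> (z' u - z' v))) (at 0)"
          unfolding inner_vec_def sum_distrib_left framework_coordinate_def
          by (rule DERIV_sum) (auto intro!: derivative_eq_intros simp: algebra_simps)
      qed
      then show ?thesis by (simp add: framework_coordinate_def)
    qed
    moreover have "D (\<Sum>i\<in>UNIV. (p u $ i - p v $ i)\<^sup>2) = 2 * ((p u - p v) \<bullet> (z u - z v))"
      by (simp add: power2_eq_square D_sum D_mult D_diff diff_mem mult_mem pA z_def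
          inner_vec_def sum_distrib_left mult.commute)
    ultimately show "(p u - p v) \<bullet> (z u - z v) = (p' u - p' v) \<bullet> (z' u - z' v)" by simp
  next
    fix v l assume l: "l \<in> loops_at G v"
    then have Inr_I: "Inr (l, i) \<in> I" for i unfolding I_def by (intro InrI) (simp add: loops_at_def)
    \<comment> \<open>A coordinate of \<open>q\<close> is itself a polynomial function agreeing at
      both points.\<close>
    have D_q: "q l $ i \<in> A \<and> D (q l $ i) = w l $ i" for i
    proof -
      let ?h = "\<lambda>x :: _ \<Rightarrow> real. x (Inr (l, i))"
      have h: "?h \<in> rat_polyfuns I" "?h ?x = ?h ?y"
        by (auto intro: rat_polyfuns_coord Inr_I simp: framework_coordinate_def)
      have "((\<lambda>t. ?h (\<lambda>i. ?y i + t * ?w i)) has_real_derivative w l $ i) (at 0)"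
        by (auto intro!: derivative_eq_intros simp: framework_coordinate_def)
      from D[OF h this] mem[OF h] show ?thesis by (simp add: framework_coordinate_def)
    qed
    have "p v \<bullet> q l = p' v \<bullet> q l"
      using equiv l by (simp add: equivalent_frameworks_def)
    then have eq: "(\<Sum>i\<in>UNIV. p v $ i * q l $ i) = (\<Sum>i\<in>UNIV. p' v $ i * q l $ i)"
      by (simp add: inner_vec_def)
    have "D (\<Sum>i\<in>UNIV. p v $ i * q l $ i) = z' v \<bullet> q l + p' v \<bullet> w l"
    proof -
      let ?h = "\<lambda>x. \<Sum>i\<in>UNIV. x (Inl (v, i)) * x (Inr (l, i))"
      have "D (?h ?x) = z' v \<bullet> q l + p' v \<bullet> w l"
      proof (rule D)
        show "?h \<in> rat_polyfuns I" by (intro sum_mult_mem_rat_polyfuns Inl_I Inr_I)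
        show "?h ?x = ?h ?y" using eq by (simp add: framework_coordinate_def)
        show "((\<lambda>t. ?h (\<lambda>i. ?y i + t * ?w i)) has_real_derivative
            z' v \<bullet> q l + p' v \<bullet> w l) (at 0)"
          unfolding inner_vec_def sum.distrib[symmetric] framework_coordinate_def
          by (rule DERIV_sum) (auto intro!: derivative_eq_intros)
      qed
      then show ?thesis by (simp add: framework_coordinate_def)
    qed
    moreover have "D (\<Sum>i\<in>UNIV. p v $ i * q l $ i) = z v \<bullet> q l + p v \<bullet> w l"
      by (simp add: D_sum D_mult mult_mem pA D_q z_def inner_vec_def sum.distrib)
    ultimately show "z v \<bullet> q l + p v \<bullet> w l = z' v \<bullet> q l + p' v \<bullet> w l" by simp
  qed
qed

text \<open>The stress at \<open>p\<close> is paired with the transported velocity \<open>z\<close>,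
  and the result is rewritten through \<open>z'\<close> and \<open>w\<close>. Both are arbitrary, so
  suitable choices isolate single facts about \<open>p'\<close>.\<close>

lemma stress_pairing_eq_0:
  fixes G :: "('v::finite, 'l) looped_graph"
    and p p' z' :: "'v \<Rightarrow> real^'d" and q w :: "'l \<Rightarrow> real^'d"
  assumes gen: "generic_framework G p q" and equiv: "equivalent_frameworks G q p p'"
    and stress: "equilibrium_stress G p q \<omega> \<mu>"
  shows "(\<Sum>v\<in>UNIV. ((\<Sum>u\<in>neighbours G v. \<omega> {u, v} *\<^sub>R (p' v - p' u))
      + (\<Sum>l\<in>loops_at G v. \<mu> l *\<^sub>R q l)) \<bullet> z' v
      + (\<Sum>l\<in>loops_at G v. \<mu> l * ((p' v - p v) \<bullet> w l))) = 0"
proof -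
  obtain z :: "'v \<Rightarrow> real^'d" where
    edge: "\<And>u v. {u, v} \<in> edges G \<Longrightarrow> (p u - p v) \<bullet> (z u - z v) = (p' u - p' v) \<bullet> (z' u - z' v)"
    and loop: "\<And>v l. l \<in> loops_at G v \<Longrightarrow> z v \<bullet> q l + p v \<bullet> w l = z' v \<bullet> q l + p' v \<bullet> w l"
    using generic_framework_transport_velocity[OF gen equiv, of z' w] by metis
  have "(\<Sum>v\<in>UNIV. \<Sum>u\<in>neighbours G v. \<omega> {u, v} * ((p v - p u) \<bullet> (z v - z u)))
      = (\<Sum>v\<in>UNIV. \<Sum>u\<in>neighbours G v. \<omega> {u, v} * ((p' v - p' u) \<bullet> (z' v - z' u)))"
    by (intro sum.cong refl) (simp add: neighbours_def insert_commute edge)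
  then have edges: "(\<Sum>v\<in>UNIV. (\<Sum>u\<in>neighbours G v. \<omega> {u, v} *\<^sub>R (p' v - p' u)) \<bullet> z' v)
      = (\<Sum>v\<in>UNIV. (\<Sum>u\<in>neighbours G v. \<omega> {u, v} *\<^sub>R (p v - p u)) \<bullet> z v)"
    unfolding edge_stress_pairing[symmetric] by simp
  have loops: "(\<Sum>l\<in>loops_at G v. \<mu> l *\<^sub>R q l) \<bullet> z' v + (\<Sum>l\<in>loops_at G v. \<mu> l * ((p' v - p v) \<bullet> w l))
      = (\<Sum>l\<in>loops_at G v. \<mu> l *\<^sub>R q l) \<bullet> z v" for v
  proof -
    have "\<mu> l * (q l \<bullet> z' v) + \<mu> l * ((p' v - p v) \<bullet> w l) = \<mu> l * (q l \<bullet> z v)"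
      if "l \<in> loops_at G v" for l
    proof -
      have "q l \<bullet> z' v + (p' v - p v) \<bullet> w l = q l \<bullet> z v"
        using loop[OF that] by (simp add: inner_diff_left inner_commute[of _ "q l"])
      then show ?thesis by (metis distrib_left)
    qed
    then show ?thesis by (simp add: inner_sum_left flip: sum.distrib)
  qed
  have "(\<Sum>v\<in>UNIV. ((\<Sum>u\<in>neighbours G v. \<omega> {u, v} *\<^sub>R (p' v - p' u))
      + (\<Sum>l\<in>loops_at G v. \<mu> l *\<^sub>R q l)) \<bullet> z' v
      + (\<Sum>l\<in>loops_at G v. \<mu> l * ((p' v - p v) \<bullet> w l)))
    = (\<Sum>v\<in>UNIV. ((\<Sum>u\<in>neighbours G v. \<omega> {u, v} *\<^sub>R (p v - p u))
      + (\<Sum>l\<in>loops_at G v. \<mu> l *\<^sub>R q l)) \<bullet> z v)"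
    by (simp add: inner_add_left add.assoc loops) (simp add: sum.distrib edges)
  also have "\<dots> = 0"
    using stress by (simp add: equilibrium_stress_def)
  finally show ?thesis .
qed

lemma equilibrium_stress_equivalent:
  fixes G :: "('v::finite, 'l) looped_graph" and p p' :: "'v \<Rightarrow> real^'d"
  assumes "generic_framework G p q" "equivalent_frameworks G q p p'"
    and "equilibrium_stress G p q \<omega> \<mu>"
  shows "equilibrium_stress G p' q \<omega> \<mu>"
proof -
  \<comment> \<open>The equilibrium defect at \<open>p'\<close>: used as the velocity, with
    \<open>w = 0\<close>, it makes the pairing a sum of squares.\<close>
  define F where "F v = (\<Sum>u\<in>neighbours G v. \<omega> {u, v} *\<^sub>R (p' v - p' u))
      + (\<Sum>l\<in>loops_at G v. \<mu> l *\<^sub>R q l)" for v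
  have "(\<Sum>v\<in>UNIV. F v \<bullet> F v) = 0"
    using stress_pairing_eq_0[OF assms, of F "\<lambda>_. 0"] by (simp add: F_def)
  then have "F v = 0" for v
    by (subst (asm) sum_nonneg_eq_0_iff) auto
  then show ?thesis by (simp add: equilibrium_stress_def F_def)
qed

lemma stressed_loop_fixed:
  fixes G :: "('v::finite, 'l) looped_graph" and p p' :: "'v \<Rightarrow> real^'d"
  assumes G: "looped_simple_graph G"
    and "generic_framework G p q" "equivalent_frameworks G q p p'"
    and "equilibrium_stress G p q \<omega> \<mu>"
    and l: "l \<in> loops_at G v" "\<mu> l \<noteq> 0"
  shows "p' v = p v"
proof -
  \<comment> \<open>Moving only the vector of \<open>l\<close>, with \<open>z' = 0\<close>, leaves
    \<open>\<mu> l\<close> times the squared length of \<open>p' v - p v\<close>.\<close>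
  let ?w = "\<lambda>k. if k = l then p' v - p v else 0"
  have fin: "finite (loops_at G u)" for u
    using G by (simp add: looped_simple_graph_def loops_at_def)
  have "(\<Sum>u\<in>UNIV. \<Sum>k\<in>loops_at G u. \<mu> k * ((p' u - p u) \<bullet> ?w k)) = 0"
    using stress_pairing_eq_0[OF assms(2-4), of "\<lambda>_. 0" ?w] by simp
  moreover have "(\<Sum>k\<in>loops_at G u. \<mu> k * ((p' u - p u) \<bullet> ?w k))
      = (if u = v then \<mu> l * ((p' v - p v) \<bullet> (p' v - p v)) else 0)" for u
  proof -
    have "(\<Sum>k\<in>loops_at G u. \<mu> k * ((p' u - p u) \<bullet> ?w k))
        = (\<Sum>k\<in>loops_at G u. if k = l then \<mu> l * ((p' u - p u) \<bullet> (p' v - p v)) else 0)"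
      by (rule sum.cong) auto
    also have "\<dots> = (if l \<in> loops_at G u then \<mu> l * ((p' u - p u) \<bullet> (p' v - p v)) else 0)"
      by (simp add: fin)
    finally show ?thesis using l(1) by (auto simp: loops_at_def)
  qed
  ultimately show ?thesis using l(2) by simp
qed

section \<open>The stress matrix\<close>

lemma stress_matrix_mult:
  assumes "looped_simple_graph G"
  shows "(stress_matrix G \<omega> *v x) $ v = (\<Sum>u\<in>neighbours G v. \<omega> {u, v} * (x $ v - x $ u))"
proof -
  \<comment> \<open>Edges have two elements, so the diagonal entry and the neighbour entries do not
    overlap.\<close>
  have v: "v \<notin> neighbours G v"
    using assms by (force simp: looped_simple_graph_def neighbours_def)
  have "(stress_matrix G \<omega> *v x) $ v = (\<Sum>u\<in>UNIV. (if u = v then (\<Sum>w\<in>neighbours G v. \<omega> {w, v}) * x $ v else 0)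
      - (if u \<in> neighbours G v then \<omega> {u, v} * x $ u else 0))"
    unfolding matrix_vector_mult_def stress_matrix_def using v
    by (auto intro!: sum.cong simp: neighbours_def insert_commute)
  also have "\<dots> = (\<Sum>u\<in>neighbours G v. \<omega> {u, v} * (x $ v - x $ u))"
    by (simp add: sum_subtractf sum.If_cases right_diff_distrib sum_distrib_right)
  finally show ?thesis .
qed

text \<open>The row space is a hyperplane with normal \<open>a\<close>, and the kernel is orthogonal
  to it, so the kernel lies on the line through \<open>a\<close>.\<close>

lemma kernel_corank_1:
  fixes M :: "real^'n^'m" and e x :: "real^'n"
  assumes rank: "rank M = CARD('n) - 1" and e: "M *v e = 0" "e \<noteq> 0" and x: "M *v x = 0"
  obtains c where "x = c *\<^sub>R e"
proof -
  obtain a where a: "a \<noteq> 0" "span (rows M) = {y. a \<bullet> y = 0}"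
    using rank lowdim_eq_hyperplane[of "rows M"] by (auto simp: row_rank_def)
  have multiple: "\<exists>c. y = c *\<^sub>R a" if y: "M *v y = 0" for y
  proof -
    \<comment> \<open>The component of \<open>y\<close> orthogonal to \<open>a\<close> lies in the
      row space, hence is orthogonal to \<open>y\<close> as well and must vanish.\<close>
    define r where "r = y - (a \<bullet> y / (a \<bullet> a)) *\<^sub>R a"
    have "a \<bullet> r = 0" using a by (simp add: r_def inner_diff_right)
    moreover from this have "y \<bullet> r = 0"
      using orthogonal_nullspace_rowspace[OF y, of r] a by (simp add: orthogonal_def)
    ultimately have "r \<bullet> r = 0" by (subst r_def) (simp add: inner_diff_left)
    then show ?thesis by (auto simp: r_def)
  qed
  obtain c d where "x = c *\<^sub>R a" "e = d *\<^sub>R a"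
    using multiple[OF x] multiple[OF e(1)] by blast
  moreover from this have "d \<noteq> 0" using e by auto
  ultimately have "x = (c / d) *\<^sub>R e" by simp
  then show thesis by (rule that)
qed

text \<open>The stress matrix acts by weighted differences, so the all-ones vector lies in its
  kernel; by the rank it spans that kernel.\<close>

lemma full_rank_stress_kernel:
  fixes G :: "('v::finite, 'l) looped_graph"
  assumes G: "looped_simple_graph G" and rank: "full_rank_stress G \<omega>"
    and x: "stress_matrix G \<omega> *v x = 0"
  shows "x $ u = x $ v"
proof -
  let ?one = "\<chi> i. 1 :: real^'v"
  have "stress_matrix G \<omega> *v ?one = 0" "?one \<noteq> 0"
    by (simp_all add: vec_eq_iff stress_matrix_mult[OF G])
  then obtain c where "x = c *\<^sub>R ?one"
    using kernel_corank_1[OF rank[unfolded full_rank_stress_def] _ _ x] by blast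
  then show ?thesis by simp
qed

lemma full_rank_stress_const:
  fixes r :: "'v::finite \<Rightarrow> real^'d"
  assumes "looped_simple_graph G" "full_rank_stress G \<omega>"
    and "\<And>v. (\<Sum>u\<in>neighbours G v. \<omega> {u, v} *\<^sub>R (r v - r u)) = 0"
  shows "r u = r v"
proof (rule vec_eq_iff[THEN iffD2], rule allI)
  fix i
  have "stress_matrix G \<omega> *v (\<chi> v. r v $ i) = 0"
  proof (rule vec_eq_iff[THEN iffD2], rule allI)
    fix v
    show "(stress_matrix G \<omega> *v (\<chi> v. r v $ i)) $ v = 0 $ v"
      using arg_cong[OF assms(3)[of v], of "\<lambda>a. a $ i"]
      by (simp add: stress_matrix_mult[OF assms(1)])
  qed
  from full_rank_stress_kernel[OF assms(1,2) this, of u v] show "r u $ i = r v $ i" by simp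
qed

section \<open>Distinct generic points and global rigidity\<close>

lemma generic_framework_inj:
  fixes G :: "('v::finite, 'l) looped_graph" and p :: "'v \<Rightarrow> real^'d"
  assumes "generic_framework G p q" "p u = p v"
  shows "u = v"
proof -
  \<comment> \<open>Types are nonempty, so one coordinate is available for comparison.\<close>
  fix i :: 'd
  let ?I = "(UNIV \<times> UNIV) <+> (loops G \<times> UNIV) :: (('v \<times> 'd) + ('l \<times> 'd)) set"
  have gen: "algebraically_independent_over_rat ?I (framework_coordinate p q)"
    using assms(1) by (simp add: generic_framework_def)
  have "(\<lambda>x :: ('v \<times> 'd) + ('l \<times> 'd) \<Rightarrow> real. x (Inl (u, i))) = (\<lambda>x. x (Inl (v, i)))"
  proof (rule rat_polyfuns_eqI[OF gen])
    show "(\<lambda>x. x (Inl (u, i))) \<in> rat_polyfuns ?I" "(\<lambda>x. x (Inl (v, i))) \<in> rat_polyfuns ?I"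
      by (intro rat_polyfuns_coord InlI UNIV_I SigmaI)+
  qed (simp add: framework_coordinate_def assms(2))
  \<comment> \<open>Evaluation at an indicator point separates two distinct coordinate
    functions.\<close>
  from fun_cong[OF this, of "\<lambda>k. if k = Inl (u, i) then 1 else 0"] show ?thesis
    by (auto split: if_splits)
qed

theorem theorem4p5:
  fixes G :: "('v::finite, 'l) looped_graph"
    and p :: "'v \<Rightarrow> real^'d" and q :: "'l \<Rightarrow> real^'d"
    and \<omega> :: "'v set \<Rightarrow> real" and \<mu> :: "'l \<Rightarrow> real"
  assumes "looped_simple_graph G"
    and "CARD('v) \<ge> 2"
    and "generic_framework G p q"
    and "equilibrium_stress G p q \<omega> \<mu>"
    and "full_rank_stress G \<omega>"
  shows "globally_rigid G p q"
  unfolding globally_rigid_def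
proof (intro allI impI)
  fix p' assume equiv: "equivalent_frameworks G q p p'"
  \<comment> \<open>The loop terms of the equilibrium equations at \<open>p\<close> and
    \<open>p'\<close> coincide and cancel in the difference.\<close>
  have "(\<Sum>u\<in>neighbours G v. \<omega> {u, v} *\<^sub>R ((p' v - p v) - (p' u - p u))) = 0" for v
  proof -
    have "(\<Sum>u\<in>neighbours G v. \<omega> {u, v} *\<^sub>R (p' v - p' u))
        = (\<Sum>u\<in>neighbours G v. \<omega> {u, v} *\<^sub>R (p v - p u))"
      using equilibrium_stress_equivalent[OF assms(3) equiv assms(4)] assms(4)
      by (simp add: equilibrium_stress_def add_eq_0_iff2)
    then show ?thesis
      by (simp add: sum_subtractf sum.distrib algebra_simps)
  qed
  then have translation: "p' u - p u = p' v - p v" for u v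
    by (rule full_rank_stress_const[OF assms(1,5), of "\<lambda>v. p' v - p v"])
  \<comment> \<open>Otherwise \<open>p\<close> itself satisfies the equations without loop terms and
    is constant by full rank, against genericity with two vertices.\<close>
  have "\<exists>v. \<exists>l \<in> loops_at G v. \<mu> l \<noteq> 0"
  proof (rule ccontr)
    assume "\<not> ?thesis"
    then have "(\<Sum>u\<in>neighbours G v. \<omega> {u, v} *\<^sub>R (p v - p u)) = 0" for v
      using assms(4) by (simp add: equilibrium_stress_def)
    then have "p u = p v" for u v
      by (rule full_rank_stress_const[OF assms(1,5)])
    then have "u = v" for u v :: 'v
      using generic_framework_inj[OF assms(3)] by blast
    then have "CARD('v) \<le> card {undefined :: 'v}"
      by (intro card_mono) blast+
    then show False using assms(2) by simp
  qed
  then obtain v l where l: "l \<in> loops_at G v" "\<mu> l \<noteq> 0" by blast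
  \<comment> \<open>A stressed loop pins its vertex, so the translation vanishes at \<open>v\<close>
    and hence everywhere.\<close>
  have "p' v = p v"
    by (rule stressed_loop_fixed[OF assms(1,3) equiv assms(4) l])
  then show "p' = p"
    using translation[of _ v] by (auto simp: fun_eq_iff)
qed

end
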